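(* For every positive integer $d$ there is $\varepsilon = \varepsilon(d) > 0$ such that, for any integer $n$ with $n \not\equiv d \pmod 2$ and any sequence $v_1,\dotsc,v_n \in \mathbb{R}^d$ of unit vectors, there are signs $\eta_1,\dotsc,\eta_n \in \{-1,+1\}$ such that \[ \Bigl\|\sum_{i=1}^n \eta_i v_i\Bigr\| \leq \sqrt{d - \varepsilon}. \] In particular, one may take $\varepsilon = 2^{-100} d^{-80}$.
   Context: $\|\cdot\|$ denotes the Euclidean norm on $\mathbb{R}^d$; unit vectors have Euclidean norm $1$. *)

theory Defs
  imports "HOL-Analysis.Analysis" "HOL-Number_Theory.Cong"
begin

end

theory Submission
  imports Defs
begin

text \<open>
  Let \<open>d\<close> be the dimension and suppose that every signed sum has squared norm above \<open>d - \<epsilon>\<close>.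
  A vertex of the polytope of all \<open>x \<in> [-1,1]\<^sup>n\<close> with \<open>\<Sum> x\<^sub>i v\<^sub>i = 0\<close> has at most \<open>d\<close> fractional
  coordinates, and independent random rounding with mean \<open>x\<close> costs \<open>\<Sum> (1 - x\<^sub>i\<^sup>2)\<close> in squared norm.
  Hence there are exactly \<open>d\<close> fractional coordinates, all of them are almost \<open>0\<close>, and the
  corresponding vectors form a basis. Moving the coefficient of any other vector \<open>w\<close> away from
  \<open>\<plusminus>1\<close>, compensating in the basis until a basis coefficient reaches \<open>\<plusminus>1\<close>, and rounding again
  shows that \<open>w\<close> is almost \<open>\<plusminus>\<close> a basis vector. So the vectors fall into \<open>d\<close> tight clusters (up to
  sign). Pair the vectors inside each cluster. By parity at most \<open>d - 1\<close> vectors are left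
  over; rounding them costs at most \<open>d - 1\<close>, while the differences of the pairs are short and cost
  almost nothing.
\<close>

section \<open>Random rounding and vertices of a section of the cube\<close>

text \<open>Derandomized rounding, one coordinate at a time: a random sign with mean
  \<open>x j\<close> raises the expected squared norm by exactly
  \<open>(1 - (x j)\<^sup>2) * (norm (v j))\<^sup>2\<close>, so one of the two signs does no worse
  than the mean. The offset \<open>z\<close> collects the signs already chosen, which the induction
  needs.\<close>

lemma exists_signs_rounding:
  fixes v :: "'i \<Rightarrow> 'a::real_inner" and x :: "'i \<Rightarrow> real"
  assumes "finite I" "\<And>i. i \<in> I \<Longrightarrow> \<bar>x i\<bar> \<le> 1"
  shows "\<exists>\<eta>::'i \<Rightarrow> real. (\<forall>i\<in>I. \<eta> i \<in> {-1, 1}) \<and>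
     (norm (z + (\<Sum>i\<in>I. \<eta> i *\<^sub>R v i)))\<^sup>2
       \<le> (norm (z + (\<Sum>i\<in>I. x i *\<^sub>R v i)))\<^sup>2 + (\<Sum>i\<in>I. (1 - (x i)\<^sup>2) * (norm (v i))\<^sup>2)"
  using assms
proof (induction I arbitrary: z rule: finite_induct)
  case empty
  then show ?case by simp
next
  case (insert j I)
  define s where "s = z + (\<Sum>i\<in>I. x i *\<^sub>R v i)"
  define f where "f t = (norm (s + t *\<^sub>R v j))\<^sup>2" for t :: real
  have f_eq: "f t = (norm s)\<^sup>2 + 2 * t * (s \<bullet> v j) + t\<^sup>2 * (norm (v j))\<^sup>2" for t
    unfolding f_def power2_norm_eq_inner
    by (simp add: inner_add_left inner_add_right inner_commute power2_eq_square algebra_simps)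
  let ?B = "f (x j) + (1 - (x j)\<^sup>2) * (norm (v j))\<^sup>2"
  have xj: "\<bar>x j\<bar> \<le> 1" using insert.prems by simp
  \<comment> \<open>The weights are the probabilities of the signs 1 and -1 for a random sign with
    mean \<open>x j\<close>.\<close>
  have avg: "(1 + x j) / 2 * f 1 + (1 - x j) / 2 * f (-1) = ?B"
    unfolding f_eq by (simp add: field_simps power2_eq_square)
  have "\<exists>e\<in>{-1, 1}. f e \<le> ?B"
  proof (rule ccontr)
    assume "\<not> ?thesis"
    then have gt: "f 1 > ?B" "f (-1) > ?B" by auto
    have "(1 + x j) / 2 * (f 1 - ?B) + (1 - x j) / 2 * (f (-1) - ?B) > 0"
    \<comment> \<open>A weight may vanish, so strictness must come from one that is positive: the
      weight of 1 if \<open>x j = 1\<close>, that of -1 otherwise.\<close>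
    proof (cases "x j = 1")
      case True
      then show ?thesis using gt by simp
    next
      case False
      then have "(1 - x j) / 2 * (f (-1) - ?B) > 0" using xj gt by (intro mult_pos_pos) auto
      moreover have "(1 + x j) / 2 * (f 1 - ?B) \<ge> 0" using xj gt by (intro mult_nonneg_nonneg) auto
      ultimately show ?thesis by linarith
    qed
    moreover have "(1 + x j) / 2 * (f 1 - ?B) + (1 - x j) / 2 * (f (-1) - ?B)
        = (1 + x j) / 2 * f 1 + (1 - x j) / 2 * f (-1) - ?B"
      by (simp add: field_simps)
    ultimately show False using avg by linarith
  qed
  then obtain e where e: "e \<in> {-1, 1}" "f e \<le> ?B" by blast
  obtain \<eta> :: "'i \<Rightarrow> real" where \<eta>: "\<forall>i\<in>I. \<eta> i \<in> {-1, 1}"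
    "(norm ((z + e *\<^sub>R v j) + (\<Sum>i\<in>I. \<eta> i *\<^sub>R v i)))\<^sup>2
       \<le> (norm ((z + e *\<^sub>R v j) + (\<Sum>i\<in>I. x i *\<^sub>R v i)))\<^sup>2 + (\<Sum>i\<in>I. (1 - (x i)\<^sup>2) * (norm (v i))\<^sup>2)"
    using insert.IH[of "z + e *\<^sub>R v j"] insert.prems by auto
  let ?\<eta> = "\<eta>(j := e)"
  have "(\<Sum>i\<in>I. ?\<eta> i *\<^sub>R v i) = (\<Sum>i\<in>I. \<eta> i *\<^sub>R v i)"
    using insert.hyps by (intro sum.cong) auto
  then have "(norm (z + (\<Sum>i\<in>insert j I. ?\<eta> i *\<^sub>R v i)))\<^sup>2
      \<le> f e + (\<Sum>i\<in>I. (1 - (x i)\<^sup>2) * (norm (v i))\<^sup>2)"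
    using \<eta>(2) insert.hyps by (simp add: f_def s_def add_ac)
  also have "\<dots> \<le> ?B + (\<Sum>i\<in>I. (1 - (x i)\<^sup>2) * (norm (v i))\<^sup>2)"
    using e by simp
  also have "\<dots> = (norm (z + (\<Sum>i\<in>insert j I. x i *\<^sub>R v i)))\<^sup>2
      + (\<Sum>i\<in>insert j I. (1 - (x i)\<^sup>2) * (norm (v i))\<^sup>2)"
    using insert.hyps by (simp add: f_def s_def add_ac)
  finally show ?case using e(1) \<eta>(1) insert.hyps by (intro exI[of _ ?\<eta>]) auto
qed

text \<open>Follow the ray from \<open>x\<close> in direction \<open>a\<close> and stop at the
  smallest exit time over the coordinates that move.\<close>

lemma exists_step_to_cube_boundary:
  fixes a x :: "'i \<Rightarrow> real"
  assumes "finite F" "\<And>i. i \<in> F \<Longrightarrow> \<bar>x i\<bar> < 1" "\<exists>i\<in>F. a i \<noteq> 0"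
  shows "\<exists>t. (\<forall>i\<in>F. \<bar>x i + t * a i\<bar> \<le> 1) \<and> (\<exists>i\<in>F. \<bar>x i + t * a i\<bar> = 1)"
proof -
  define G where "G = {i\<in>F. a i \<noteq> 0}"
  \<comment> \<open>The solution of \<open>x i + T i * a i = sgn (a i)\<close>: the time at which
    coordinate \<open>i\<close> reaches the face it moves towards.\<close>
  define T where "T i = (1 - sgn (a i) * x i) / \<bar>a i\<bar>" for i
  have G: "finite G" "G \<noteq> {}" using assms by (auto simp: G_def)
  have "Min (T ` G) \<in> T ` G" using G by (intro Min_in) auto
  then obtain k where k: "k \<in> G" "Min (T ` G) = T k" by auto
  have Tk: "T k \<le> T i" if "i \<in> G" for i
    using k(2) G that by (metis Min_le finite_imageI imageI)
  have Tpos: "T i > 0" if "i \<in> G" for i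
    using that assms(2)[of i] by (auto simp: T_def G_def sgn_if abs_less_iff intro!: divide_pos_pos)
  have "\<bar>x i + T k * a i\<bar> \<le> 1" if "i \<in> F" for i
  proof (cases "a i = 0")
    case True
    then show ?thesis using assms(2)[OF that] by simp
  next
    case False
    then have i: "i \<in> G" using that by (simp add: G_def)
    have 1: "T k * \<bar>a i\<bar> \<le> 1 - sgn (a i) * x i"
      using Tk[OF i] False by (simp add: T_def[of i] pos_le_divide_eq)
    have 2: "T k * \<bar>a i\<bar> \<ge> 0" using Tpos[OF k(1)] by simp
    show ?thesis
      using 1 2 assms(2)[OF that] False by (cases "a i > 0") (auto simp: abs_le_iff)
  qed
  moreover have "\<bar>x k + T k * a k\<bar> = 1"
    using k(1) by (cases "a k > 0") (auto simp: T_def G_def)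
  ultimately show ?thesis using k(1) by (intro exI[of _ "T k"]) (auto simp: G_def)
qed

text \<open>Take a balanced point with the fewest fractional coordinates. A linear relation among
  their vectors would give a direction that keeps the sum at 0, and moving along it to the boundary
  would make one more coordinate \<open>\<plusminus>1\<close>.\<close>

lemma exists_balanced_vertex:
  fixes v :: "'i \<Rightarrow> 'a::real_vector"
  assumes "finite I"
  obtains x :: "'i \<Rightarrow> real" where
    "\<And>i. i \<in> I \<Longrightarrow> \<bar>x i\<bar> \<le> 1" "(\<Sum>i\<in>I. x i *\<^sub>R v i) = 0"
    "\<forall>a. (\<Sum>i\<in>{i\<in>I. \<bar>x i\<bar> < 1}. a i *\<^sub>R v i) = 0 \<longrightarrow> (\<forall>i\<in>{i\<in>I. \<bar>x i\<bar> < 1}. a i = 0)"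
proof -
  define P where "P x \<longleftrightarrow> (\<forall>i\<in>I. \<bar>x i\<bar> \<le> 1) \<and> (\<Sum>i\<in>I. x i *\<^sub>R v i) = 0" for x :: "'i \<Rightarrow> real"
  define fr where "fr x = {i\<in>I. \<bar>x i\<bar> < 1}" for x :: "'i \<Rightarrow> real"
  have "P (\<lambda>_. 0)" by (simp add: P_def)
  then obtain x where x: "P x" and min: "\<And>y. P y \<Longrightarrow> card (fr x) \<le> card (fr y)"
    using ex_has_least_nat[of P "\<lambda>_. 0" "\<lambda>x. card (fr x)"] by blast
  have fin: "finite (fr y)" for y using assms by (simp add: fr_def)
  have indep: "a i = 0" if a: "(\<Sum>i\<in>fr x. a i *\<^sub>R v i) = 0" and i: "i \<in> fr x" for a i
  proof (rule ccontr)
    assume "a i \<noteq> 0"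
    with i obtain t where t: "\<forall>i\<in>fr x. \<bar>x i + t * a i\<bar> \<le> 1" "\<exists>i\<in>fr x. \<bar>x i + t * a i\<bar> = 1"
      using exists_step_to_cube_boundary[OF fin, of x x a] by (auto simp: fr_def)
    define y where "y i = (if i \<in> fr x then x i + t * a i else x i)" for i
    have "(\<Sum>i\<in>I. y i *\<^sub>R v i) = (\<Sum>i\<in>I. x i *\<^sub>R v i + (if i \<in> fr x then t *\<^sub>R a i *\<^sub>R v i else 0))"
      by (intro sum.cong) (auto simp: y_def algebra_simps)
    also have "\<dots> = (\<Sum>i\<in>fr x. t *\<^sub>R a i *\<^sub>R v i)"
      using x assms by (simp add: sum.distrib P_def sum.If_cases fr_def Int_def)
    also have "\<dots> = 0" unfolding scaleR_sum_right[symmetric] a by simp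
    finally have "P y" using x t(1) by (auto simp: P_def y_def)
    have "fr y \<subseteq> fr x" by (auto simp: y_def fr_def split: if_splits)
    moreover obtain k where "k \<in> fr x" "\<bar>y k\<bar> = 1" using t(2) by (auto simp: y_def)
    then have "k \<in> fr x - fr y" by (simp add: fr_def)
    ultimately have "fr y \<subset> fr x" by blast
    then have "card (fr y) < card (fr x)" using fin by (intro psubset_card_mono)
    with min[OF \<open>P y\<close>] show False by simp
  qed
  show thesis
  proof (rule that)
    show "\<forall>a. (\<Sum>i\<in>{i\<in>I. \<bar>x i\<bar> < 1}. a i *\<^sub>R v i) = 0 \<longrightarrow> (\<forall>i\<in>{i\<in>I. \<bar>x i\<bar> < 1}. a i = 0)"
      using indep unfolding fr_def by blast
  qed (use x in \<open>auto simp: P_def\<close>)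
qed

section \<open>Linear algebra of families\<close>

text \<open>Passes from independence of a family, where a repeated vector is a relation, to
  independence of a set, for which the dimension bounds are available.\<close>

lemma independent_family_imp_independent_image:
  fixes v :: "'i \<Rightarrow> 'a::real_vector"
  assumes "finite F" and ind: "\<forall>a. (\<Sum>i\<in>F. a i *\<^sub>R v i) = 0 \<longrightarrow> (\<forall>i\<in>F. a i = 0)"
  shows "inj_on v F" "independent (v ` F)"
proof -
  show inj: "inj_on v F"
  proof (rule inj_onI, rule ccontr)
    fix i j assume ij: "i \<in> F" "j \<in> F" "v i = v j" "i \<noteq> j"
    let ?a = "\<lambda>k. if k = i then 1 else if k = j then -1 else (0::real)"
    have "(\<Sum>k\<in>F. ?a k *\<^sub>R v k) = (\<Sum>k\<in>{i, j}. ?a k *\<^sub>R v k)"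
      using ij assms(1) by (intro sum.mono_neutral_right) auto
    also have "\<dots> = 0" using ij by auto
    finally show False using ind[rule_format, of ?a i] ij by simp
  qed
  show "independent (v ` F)"
  proof (rule independent_if_scalars_zero)
    fix f b assume s: "(\<Sum>b\<in>v ` F. f b *\<^sub>R b) = 0" and b: "b \<in> v ` F"
    have "(\<Sum>i\<in>F. f (v i) *\<^sub>R v i) = 0" using s inj by (simp add: sum.reindex)
    then show "f b = 0" using ind[rule_format, of "\<lambda>i. f (v i)"] b by auto
  qed (use assms in simp)
qed

text \<open>Triangle inequality followed by Cauchy-Schwarz. The factor \<open>card F\<close> is the
  price for unit vectors that need not be orthogonal.\<close>

lemma norm_lincomb_unit_squared_le:
  fixes v :: "'i \<Rightarrow> 'a::real_normed_vector"
  assumes "\<And>i. i \<in> F \<Longrightarrow> norm (v i) = 1"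
  shows "(norm (\<Sum>i\<in>F. b i *\<^sub>R v i))\<^sup>2 \<le> real (card F) * (\<Sum>i\<in>F. (b i)\<^sup>2)"
proof -
  have "norm (\<Sum>i\<in>F. b i *\<^sub>R v i) \<le> (\<Sum>i\<in>F. \<bar>b i\<bar>)"
    using assms by (intro sum_norm_le) simp
  then have "(norm (\<Sum>i\<in>F. b i *\<^sub>R v i))\<^sup>2 \<le> (\<Sum>i\<in>F. \<bar>b i\<bar>)\<^sup>2"
    by (intro power_mono) auto
  also have "\<dots> \<le> (\<Sum>i\<in>F. \<bar>b i\<bar>\<^sup>2) * real (card F)"
    by (rule sum_squared_le_sum_of_squares)
  finally show ?thesis by (simp add: mult.commute)
qed

section \<open>Pairing inside clusters\<close>

text \<open>Here \<open>L\<close> is meant as the unpaired indices and each \<open>u k\<close> as a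
  combination of one pair. Which pair it was is forgotten; only the ability to translate signs back
  is kept.\<close>

definition signs_reduce_to ::
    "('i \<Rightarrow> 'a::real_vector) \<Rightarrow> 'i set \<Rightarrow> 'i set \<Rightarrow> nat \<Rightarrow> (nat \<Rightarrow> 'a) \<Rightarrow> bool" where
  "signs_reduce_to v S L m u \<longleftrightarrow>
    (\<forall>\<mu> \<theta>. (\<forall>i\<in>L. \<mu> i \<in> {-1, 1::real}) \<longrightarrow> (\<forall>k<m. \<theta> k \<in> {-1, 1}) \<longrightarrow>
      (\<exists>\<eta>. (\<forall>i\<in>S. \<eta> i \<in> {-1, 1}) \<and>
        (\<Sum>i\<in>S. \<eta> i *\<^sub>R v i) = (\<Sum>i\<in>L. \<mu> i *\<^sub>R v i) + (\<Sum>k<m. \<theta> k *\<^sub>R u k)))"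

lemma signs_reduce_toE:
  assumes "signs_reduce_to v S L m u"
    and "\<And>i. i \<in> L \<Longrightarrow> \<mu> i \<in> {-1, 1::real}" "\<And>k. k < m \<Longrightarrow> \<theta> k \<in> {-1, 1}"
  obtains \<eta> where "\<forall>i\<in>S. \<eta> i \<in> {-1, 1}"
    "(\<Sum>i\<in>S. \<eta> i *\<^sub>R v i) = (\<Sum>i\<in>L. \<mu> i *\<^sub>R v i) + (\<Sum>k<m. \<theta> k *\<^sub>R u k)"
  using assms(1)[unfolded signs_reduce_to_def, THEN spec, THEN spec, of \<mu> \<theta>] assms(2,3) by blast

text \<open>As long as two indices share a cluster, remove both and record their short combination.
  Each removal takes two indices, so parity is preserved, and the process stops when
  \<open>c\<close> is injective on what remains.\<close>

lemma exists_cluster_pairing: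
  fixes v :: "'i \<Rightarrow> 'a::real_normed_vector"
  assumes "finite S"
    and "\<And>i j. i \<in> S \<Longrightarrow> j \<in> S \<Longrightarrow> c i = c j \<Longrightarrow> \<exists>s\<in>{-1, 1::real}. norm (v i + s *\<^sub>R v j) \<le> r"
  shows "\<exists>L m (u::nat \<Rightarrow> 'a). L \<subseteq> S \<and> inj_on c L \<and> even (card S - card L) \<and>
    (\<forall>k<m. norm (u k) \<le> r) \<and> signs_reduce_to v S L m u"
  using assms
proof (induction "card S" arbitrary: S rule: less_induct)
  case less
  show ?case
  proof (cases "inj_on c S")
    case True
    then show ?thesis by (intro exI[of _ S] exI[of _ "0::nat"]) (auto simp: signs_reduce_to_def)
  next
    case False
    then obtain i j where ij: "i \<in> S" "j \<in> S" "i \<noteq> j" "c i = c j" by (auto simp: inj_on_def)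
    then obtain s :: real where s: "s \<in> {-1, 1}" "norm (v i + s *\<^sub>R v j) \<le> r"
      using less.prems(2) by blast
    define S' where "S' = S - {i, j}"
    have S: "S = insert i (insert j S')" "i \<notin> insert j S'" "j \<notin> S'" "finite S'"
      using ij less.prems by (auto simp: S'_def)
    have card_S: "card S = Suc (Suc (card S'))" unfolding S(1) using S(2-4) by simp
    have "card S' < card S" using card_S by simp
    moreover have "\<exists>s\<in>{-1, 1::real}. norm (v i + s *\<^sub>R v j) \<le> r"
      if "i \<in> S'" "j \<in> S'" "c i = c j" for i j
      using less.prems(2) that by (simp add: S'_def)
    ultimately obtain L m and u :: "nat \<Rightarrow> 'a" where IH: "L \<subseteq> S'" "inj_on c L"
      "even (card S' - card L)" "\<forall>k<m. norm (u k) \<le> r" "signs_reduce_to v S' L m u"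
      using less.hyps[of S'] S(4) by blast
    \<comment> \<open>The subtraction of cardinalities is truncated; this bound lets the two removed
      indices add exactly 2 to it.\<close>
    have "card L \<le> card S'" using IH S by (intro card_mono)
    then have ev: "even (card S - card L)" using IH(3) card_S by (simp add: Suc_diff_le)
    let ?u = "u(m := v i + s *\<^sub>R v j)"
    have "\<exists>\<eta>. (\<forall>i\<in>S. \<eta> i \<in> {-1, 1}) \<and>
        (\<Sum>i\<in>S. \<eta> i *\<^sub>R v i) = (\<Sum>i\<in>L. \<mu> i *\<^sub>R v i) + (\<Sum>k<Suc m. \<theta> k *\<^sub>R ?u k)"
      if \<mu>: "\<forall>i\<in>L. \<mu> i \<in> {-1, 1::real}" and \<theta>: "\<forall>k<Suc m. \<theta> k \<in> {-1, 1}" for \<mu> \<theta>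
    proof -
      obtain \<eta> where \<eta>: "\<forall>i\<in>S'. \<eta> i \<in> {-1, 1}"
        "(\<Sum>i\<in>S'. \<eta> i *\<^sub>R v i) = (\<Sum>i\<in>L. \<mu> i *\<^sub>R v i) + (\<Sum>k<m. \<theta> k *\<^sub>R u k)"
        using signs_reduce_toE[OF IH(5), of \<mu> \<theta>] \<mu> \<theta> less_SucI by blast
      \<comment> \<open>The sign of the new vector \<open>v i + s *\<^sub>R v j\<close> is
        distributed over its two terms.\<close>
      let ?\<eta> = "\<eta>(i := \<theta> m, j := \<theta> m * s)"
      have "(\<Sum>i\<in>S'. ?\<eta> i *\<^sub>R v i) = (\<Sum>i\<in>S'. \<eta> i *\<^sub>R v i)"
        using S by (intro sum.cong) auto
      then have "(\<Sum>i\<in>S. ?\<eta> i *\<^sub>R v i)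
          = \<theta> m *\<^sub>R v i + (\<theta> m * s) *\<^sub>R v j + (\<Sum>i\<in>S'. \<eta> i *\<^sub>R v i)"
        unfolding S(1) using S(2-4) by simp
      also have "\<dots> = (\<Sum>i\<in>L. \<mu> i *\<^sub>R v i) + (\<Sum>k<Suc m. \<theta> k *\<^sub>R ?u k)"
        unfolding \<eta>(2) by (simp add: algebra_simps)
      finally show ?thesis using \<eta>(1) \<theta> s(1) S by (intro exI[of _ ?\<eta>]) auto
    qed
    then have "signs_reduce_to v S L (Suc m) ?u" unfolding signs_reduce_to_def by blast
    moreover have "L \<subseteq> S" using IH(1) S(1) by blast
    moreover have "\<forall>k<Suc m. norm (?u k) \<le> r" using IH(4) s(2) by (simp add: less_Suc_eq)
    ultimately show ?thesis using IH(2) ev by blast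
  qed
qed

section \<open>Vectors outside the basis lie close to it\<close>

text \<open>Shrinking the coefficient of \<open>v j\<close> by the factor \<open>1 - t\<close> and
  compensating through \<open>w\<close> keeps the total small, so \<open>large\<close> bounds
  \<open>(1 - t)\<^sup>2\<close> plus the squares of the \<open>t * a i\<close>. At the largest
  useful \<open>t\<close>, one basis term alone nearly exhausts this bound; hence the other
  coefficients are tiny and the dominant one is almost \<open>\<plusminus>1\<close>.\<close>

lemma near_basis_vector_of_signed_sums_large:
  fixes v :: "'i \<Rightarrow> 'a::real_inner"
  assumes I: "finite I" "F \<subseteq> I" "j \<in> I - F" and unit: "\<And>i. i \<in> I \<Longrightarrow> norm (v i) = 1"
    and card_F: "card F = d" and \<epsilon>: "\<epsilon> \<ge> 0" "33 * real d ^ 3 * \<epsilon> \<le> 1"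
    and large: "\<And>x. (\<And>i. i \<in> I \<Longrightarrow> \<bar>x i\<bar> \<le> 1) \<Longrightarrow>
      real d - \<epsilon> < (norm (\<Sum>i\<in>I. x i *\<^sub>R v i))\<^sup>2 + (\<Sum>i\<in>I. 1 - (x i)\<^sup>2)"
    and x: "\<And>i. i \<in> I - F \<Longrightarrow> \<bar>x i\<bar> = 1" "(\<Sum>i\<in>I. x i *\<^sub>R v i) = 0" "(\<Sum>i\<in>F. (x i)\<^sup>2) \<le> \<epsilon>"
    and w: "v j = (\<Sum>i\<in>F. a i *\<^sub>R v i)"
  shows "\<exists>i\<in>F. \<exists>s\<in>{-1, 1::real}. (norm (v j - s *\<^sub>R v i))\<^sup>2 \<le> 8 * real d ^ 2 * \<epsilon>"
proof -
  have fin: "finite F" using I finite_subset by blast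
  have "F \<noteq> {}" using w unit[of j] I by auto
  then have d1: "d \<ge> 1" using card_F fin by (metis One_nat_def Suc_leI card_gt_0_iff)
  have d_pow: "real d \<le> real d ^ 3" "real d ^ 2 \<le> real d ^ 3" "1 \<le> real d"
    using d1 power_increasing[of 1 3 "real d"] power_increasing[of 2 3 "real d"] by auto
  have eps_d: "33 * (real d * \<epsilon>) \<le> 1" "33 * (real d ^ 2 * \<epsilon>) \<le> 1" "33 * \<epsilon> \<le> 1"
    using \<epsilon> mult_right_mono[OF d_pow(1) \<epsilon>(1)] mult_right_mono[OF d_pow(2) \<epsilon>(1)]
      mult_right_mono[OF d_pow(3) \<epsilon>(1)] by auto
  \<comment> \<open>One \<open>\<epsilon>\<close> comes from \<open>large\<close>, and
    \<open>d * \<epsilon>\<close> from the squared norm of the perturbed sum.\<close>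
  define \<epsilon>' where "\<epsilon>' = (real d + 1) * \<epsilon>"
  have xj: "\<bar>x j\<bar> = 1" using x(1) I by simp
  then have xj2: "(x j)\<^sup>2 = 1" by (metis one_power2 power2_abs)
  have key: "(1 - t)\<^sup>2 + (\<Sum>i\<in>F. (t * a i)\<^sup>2) < 1 + \<epsilon>'"
    if t: "0 \<le> t" "t \<le> 2" "\<And>i. i \<in> F \<Longrightarrow> \<bar>t * a i\<bar> \<le> 1" for t
  proof -
    \<comment> \<open>The old values on \<open>F\<close> are overwritten, not shifted. The new sum
      is therefore minus their contribution to the old one, which is small by
      \<open>x(3)\<close>.\<close>
    define y where "y i = (if i \<in> F then x j * t * a i else if i = j then x j * (1 - t) else x i)" for i
    have y1: "\<bar>y i\<bar> \<le> 1" if "i \<in> I" for i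
      using that t x(1)[of i] xj by (auto simp: y_def abs_mult)
    have split: "(\<Sum>i\<in>I. g i) = (\<Sum>i\<in>F. g i) + (g j + (\<Sum>i\<in>I - F - {j}. g i))"
      for g :: "'i \<Rightarrow> 'b::comm_monoid_add"
      using sum.subset_diff[of F I g] sum.remove[of "I - F" j g] I by (simp add: add.commute)
    have rest: "(\<Sum>i\<in>I - F - {j}. y i *\<^sub>R v i) = (\<Sum>i\<in>I - F - {j}. x i *\<^sub>R v i)"
      by (intro sum.cong) (auto simp: y_def)
    have yF: "(\<Sum>i\<in>F. y i *\<^sub>R v i) = (x j * t) *\<^sub>R v j"
      unfolding w scaleR_sum_right by (intro sum.cong) (auto simp: y_def)
    have "y j = x j * (1 - t)" using I by (simp add: y_def)
    then have "(\<Sum>i\<in>I. y i *\<^sub>R v i) = x j *\<^sub>R v j + (\<Sum>i\<in>I - F - {j}. x i *\<^sub>R v i)"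
      unfolding split yF rest by (simp add: scaleR_diff_left right_diff_distrib)
    also have "\<dots> = - (\<Sum>i\<in>F. x i *\<^sub>R v i)"
      using x(2) unfolding split by (simp add: eq_neg_iff_add_eq_0 add.commute)
    finally have "(norm (\<Sum>i\<in>I. y i *\<^sub>R v i))\<^sup>2 = (norm (\<Sum>i\<in>F. x i *\<^sub>R v i))\<^sup>2" by simp
    also have "\<dots> \<le> real d * (\<Sum>i\<in>F. (x i)\<^sup>2)"
      unfolding card_F[symmetric] using unit I by (intro norm_lincomb_unit_squared_le) auto
    also have "\<dots> \<le> real d * \<epsilon>" using x(3) by (intro mult_left_mono) auto
    finally have n: "(norm (\<Sum>i\<in>I. y i *\<^sub>R v i))\<^sup>2 \<le> real d * \<epsilon>" .
    have "(\<Sum>i\<in>I - F - {j}. 1 - (y i)\<^sup>2) = 0"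
    proof (intro sum.neutral ballI)
      fix i assume "i \<in> I - F - {j}"
      then have "\<bar>y i\<bar> = 1" using x(1) by (auto simp: y_def)
      then show "1 - (y i)\<^sup>2 = 0" by (metis diff_self one_power2 power2_abs)
    qed
    moreover have "(\<Sum>i\<in>F. 1 - (y i)\<^sup>2) = real d - (\<Sum>i\<in>F. (t * a i)\<^sup>2)"
      using card_F xj2 by (simp add: sum_subtractf y_def power_mult_distrib)
    moreover have "(y j)\<^sup>2 = (1 - t)\<^sup>2" using I xj2 by (simp add: y_def power_mult_distrib)
    ultimately have "(\<Sum>i\<in>I. 1 - (y i)\<^sup>2) = real d - (\<Sum>i\<in>F. (t * a i)\<^sup>2) + 1 - (1 - t)\<^sup>2"
      unfolding split by simp
    then show ?thesis using large[of y] y1 n by (simp add: \<epsilon>'_def algebra_simps)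
  qed
  define M where "M = Max ((\<lambda>i. \<bar>a i\<bar>) ` F)"
  have M_ge: "\<bar>a i\<bar> \<le> M" if "i \<in> F" for i using that fin by (simp add: M_def)
  have "M \<in> (\<lambda>i. \<bar>a i\<bar>) ` F" unfolding M_def using fin \<open>F \<noteq> {}\<close> by (intro Max_in) auto
  then obtain k where k: "k \<in> F" "\<bar>a k\<bar> = M" by auto
  \<comment> \<open>Each left side is a sum of two terms of size at most 1/33, and 2/33 <
    1/16.\<close>
  have \<epsilon>'_small: "\<epsilon>' \<le> 1 / 16" "real d * \<epsilon>' \<le> 1 / 16"
    using eps_d by (auto simp: \<epsilon>'_def algebra_simps power2_eq_square)
  have nF: "(norm (\<Sum>i\<in>F. b i *\<^sub>R v i))\<^sup>2 \<le> real d * (\<Sum>i\<in>F. (b i)\<^sup>2)" for b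
    unfolding card_F[symmetric] using unit I by (intro norm_lincomb_unit_squared_le) auto
  \<comment> \<open>Otherwise \<open>t = 2\<close> is admissible. There
    \<open>(1 - t)\<^sup>2 = 1\<close> uses up the bound, so all \<open>a i\<close> are tiny,
    contradicting that \<open>v j\<close> is a unit vector. The bound makes \<open>t = 1 / M\<close>
    admissible below.\<close>
  have M_gt: "M > 1 / 2"
  proof (rule ccontr)
    assume "\<not> M > 1 / 2"
    then have "\<bar>2 * a i\<bar> \<le> 1" if "i \<in> F" for i using M_ge[OF that] by simp
    then have "(\<Sum>i\<in>F. (2 * a i)\<^sup>2) < \<epsilon>'" using key[of 2] by simp
    then have "(\<Sum>i\<in>F. (a i)\<^sup>2) \<le> \<epsilon>'"
      using sum_nonneg[of F "\<lambda>i. (a i)\<^sup>2"] by (simp add: power_mult_distrib flip: sum_distrib_left)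
    then have "(norm (v j))\<^sup>2 \<le> real d * \<epsilon>'"
      unfolding w using nF[of a] by (meson mult_left_mono of_nat_0_le_iff order_trans)
    then show False using \<epsilon>'_small unit[of j] I by simp
  qed
  define t where "t = 1 / M"
  have tM: "t * M = 1" "t > 0" "t \<le> 2" using M_gt by (auto simp: t_def field_simps)
  have "\<bar>t * a i\<bar> \<le> 1" if "i \<in> F" for i
    using mult_left_mono[OF M_ge[OF that], of t] tM by (simp add: abs_mult)
  then have "(1 - t)\<^sup>2 + (\<Sum>i\<in>F. (t * a i)\<^sup>2) < 1 + \<epsilon>'" using key tM by simp
  moreover have "(t * a k)\<^sup>2 = 1"
    using tM k by (metis abs_mult abs_of_pos one_power2 power2_abs)
  \<comment> \<open>The term of \<open>k\<close> equals 1 and cancels the 1 on the right.\<close>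
  ultimately have *: "(1 - t)\<^sup>2 + (\<Sum>i\<in>F - {k}. (t * a i)\<^sup>2) < \<epsilon>'"
    using fin k by (simp add: sum.remove)
  have sn: "(\<Sum>i\<in>F - {k}. (t * a i)\<^sup>2) \<ge> 0" by (intro sum_nonneg) auto
  have "(1 - t)\<^sup>2 \<le> (1/2)\<^sup>2" using * sn \<epsilon>'_small by (simp add: power2_eq_square)
  then have "\<bar>1 - t\<bar> \<le> 1/2" by (simp add: abs_le_square_iff[symmetric])
  then have "t \<ge> 1/2" by linarith
  then have M2: "M \<le> 2" using tM M_gt mult_right_mono[of "1/2" t M] by simp
  have Mt: "M * (1 - t) = M - 1" "M * (t * a i) = a i" for i
    using tM by (simp_all add: algebra_simps flip: mult.assoc)
  \<comment> \<open>Undo the scaling by \<open>t = 1 / M\<close>; since \<open>M \<le> 2\<close>,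
    this costs a factor of at most 4.\<close>
  have "M\<^sup>2 * ((1 - t)\<^sup>2 + (\<Sum>i\<in>F - {k}. (t * a i)\<^sup>2)) = (M - 1)\<^sup>2 + (\<Sum>i\<in>F - {k}. (a i)\<^sup>2)"
    by (simp add: distrib_left sum_distrib_left Mt flip: power_mult_distrib)
  moreover have "M\<^sup>2 * ((1 - t)\<^sup>2 + (\<Sum>i\<in>F - {k}. (t * a i)\<^sup>2)) \<le> 2\<^sup>2 * \<epsilon>'"
    using * sn M2 M_gt by (intro mult_mono power_mono) auto
  ultimately have **: "(M - 1)\<^sup>2 + (\<Sum>i\<in>F - {k}. (a i)\<^sup>2) \<le> 4 * \<epsilon>'" by simp
  define s where "s = (if a k \<ge> 0 then 1 else - 1 :: real)"
  define b where "b i = (if i = k then a k - s else a i)" for i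
  have "v j - s *\<^sub>R v k = (\<Sum>i\<in>F. b i *\<^sub>R v i)"
    unfolding w using fin k(1) by (simp add: sum.remove b_def algebra_simps)
  moreover have "(a k - s)\<^sup>2 = (M - 1)\<^sup>2"
    using k(2) by (auto simp: s_def power2_eq_square algebra_simps)
  then have "(\<Sum>i\<in>F. (b i)\<^sup>2) \<le> 4 * \<epsilon>'"
    using ** fin k(1) by (simp add: sum.remove b_def)
  then have "real d * (\<Sum>i\<in>F. (b i)\<^sup>2) \<le> real d * (4 * \<epsilon>')" by (intro mult_left_mono) auto
  ultimately have "(norm (v j - s *\<^sub>R v k))\<^sup>2 \<le> real d * (4 * \<epsilon>')" using nF[of b] by simp
  also have "\<dots> = 4 * (real d ^ 2 * \<epsilon>) + 4 * (real d * \<epsilon>)"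
    by (simp add: \<epsilon>'_def algebra_simps power2_eq_square)
  also have "\<dots> \<le> 8 * real d ^ 2 * \<epsilon>"
    using mult_right_mono[OF self_le_power[OF d_pow(3), of 2] \<epsilon>(1)] by (simp add: mult.commute)
  finally have "(norm (v j - s *\<^sub>R v k))\<^sup>2 \<le> 8 * real d ^ 2 * \<epsilon>" .
  moreover have "s \<in> {-1, 1}" by (simp add: s_def)
  ultimately show ?thesis using k(1) by blast
qed

section \<open>Signs for tightly clustered vectors\<close>

text \<open>The leftover vectors lie in distinct clusters, so parity leaves at most
  \<open>DIM('a) - 1\<close> of them, at cost 1 each. The pair vectors are rounded from a balanced
  vertex: however many there are, at most \<open>DIM('a)\<close> are fractional, each costing at
  most \<open>r\<^sup>2\<close>.\<close>

lemma exists_signs_of_clusters: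
  fixes v :: "'i \<Rightarrow> 'a::euclidean_space"
  assumes I: "finite I" and unit: "\<And>i. i \<in> I \<Longrightarrow> norm (v i) = 1"
    and c: "c ` I \<subseteq> F" "finite F" "card F \<le> DIM('a)"
    and parity: "even (card I) \<noteq> even DIM('a)"
    and close: "\<And>i j. i \<in> I \<Longrightarrow> j \<in> I \<Longrightarrow> c i = c j \<Longrightarrow> \<exists>s\<in>{-1, 1::real}. norm (v i + s *\<^sub>R v j) \<le> r"
  shows "\<exists>\<eta>. (\<forall>i\<in>I. \<eta> i \<in> {-1, 1}) \<and>
    (norm (\<Sum>i\<in>I. \<eta> i *\<^sub>R v i))\<^sup>2 \<le> real DIM('a) - 1 + real DIM('a) * r\<^sup>2"
proof -
  obtain L m and u :: "nat \<Rightarrow> 'a" where L: "L \<subseteq> I" "inj_on c L" "even (card I - card L)"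
    and u: "\<And>k. k < m \<Longrightarrow> norm (u k) \<le> r"
    and signs: "signs_reduce_to v I L m u"
    using exists_cluster_pairing[of I c v r] I close by blast
  have finL: "finite L" using L I finite_subset by blast
  have "card L \<le> card F"
    using L c by (intro card_inj_on_le[of c]) auto
  moreover have "card L \<le> card I" using L I by (intro card_mono)
  then have "even (card L) = even (card I)" using L(3) by simp
  ultimately have "card L < DIM('a)" using parity c(3) by (metis le_neq_implies_less order_trans)
  then have cardL: "real (card L) \<le> real DIM('a) - 1" by simp
  obtain x where x: "\<And>k. k \<in> {..<m} \<Longrightarrow> \<bar>x k\<bar> \<le> 1" "(\<Sum>k<m. x k *\<^sub>R u k) = 0"
    "\<forall>a. (\<Sum>k\<in>{k\<in>{..<m}. \<bar>x k\<bar> < 1}. a k *\<^sub>R u k) = 0 \<longrightarrow> (\<forall>k\<in>{k\<in>{..<m}. \<bar>x k\<bar> < 1}. a k = 0)"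
    using exists_balanced_vertex[of "{..<m}" u] by blast
  define G where "G = {k\<in>{..<m}. \<bar>x k\<bar> < 1}"
  have G: "finite G" "\<forall>a. (\<Sum>k\<in>G. a k *\<^sub>R u k) = 0 \<longrightarrow> (\<forall>k\<in>G. a k = 0)"
    using x(3) unfolding G_def by simp_all
  note indep = independent_family_imp_independent_image[of G u, OF G]
  have cardG: "card G \<le> DIM('a)"
    using independent_bound[OF indep(2)] card_image[OF indep(1)] by simp
  obtain \<mu> where \<mu>: "\<forall>i\<in>L. \<mu> i \<in> {-1, 1::real}"
    "(norm (\<Sum>i\<in>L. \<mu> i *\<^sub>R v i))\<^sup>2 \<le> (\<Sum>i\<in>L. (norm (v i))\<^sup>2)"
    using exists_signs_rounding[OF finL, of "\<lambda>_. 0" 0 v] by auto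
  \<comment> \<open>The leftover sum serves as the offset. As the pair vectors balance to 0 at
    \<open>x\<close>, the two costs simply add, without a cross term.\<close>
  obtain \<theta> where \<theta>: "\<forall>k\<in>{..<m}. \<theta> k \<in> {-1, 1::real}"
    "(norm ((\<Sum>i\<in>L. \<mu> i *\<^sub>R v i) + (\<Sum>k<m. \<theta> k *\<^sub>R u k)))\<^sup>2 \<le>
     (norm ((\<Sum>i\<in>L. \<mu> i *\<^sub>R v i) + (\<Sum>k<m. x k *\<^sub>R u k)))\<^sup>2 + (\<Sum>k<m. (1 - (x k)\<^sup>2) * (norm (u k))\<^sup>2)"
    using exists_signs_rounding[of "{..<m}" x "\<Sum>i\<in>L. \<mu> i *\<^sub>R v i" u] x(1) by blast
  have "(\<Sum>i\<in>L. (norm (v i))\<^sup>2) = real (card L)"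
    using unit L by (simp add: subset_eq)
  moreover have "(\<Sum>k<m. (1 - (x k)\<^sup>2) * (norm (u k))\<^sup>2) = (\<Sum>k\<in>G. (1 - (x k)\<^sup>2) * (norm (u k))\<^sup>2)"
  proof (intro sum.mono_neutral_right ballI)
    fix k assume "k \<in> {..<m} - G"
    then have "\<bar>x k\<bar> = 1" using x(1)[of k] by (force simp: G_def)
    then have "(x k)\<^sup>2 = 1" by (metis one_power2 power2_abs)
    then show "(1 - (x k)\<^sup>2) * (norm (u k))\<^sup>2 = 0" by simp
  qed (auto simp: G_def)
  moreover have "(\<Sum>k\<in>G. (1 - (x k)\<^sup>2) * (norm (u k))\<^sup>2) \<le> (\<Sum>k\<in>G. 1 * r\<^sup>2)"
    using u by (intro sum_mono mult_mono power_mono) (auto simp: G_def)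
  moreover have "(\<Sum>k\<in>G. 1 * r\<^sup>2) \<le> real DIM('a) * r\<^sup>2"
    using cardG by (auto intro!: mult_right_mono)
  ultimately have "(norm ((\<Sum>i\<in>L. \<mu> i *\<^sub>R v i) + (\<Sum>k<m. \<theta> k *\<^sub>R u k)))\<^sup>2
      \<le> real DIM('a) - 1 + real DIM('a) * r\<^sup>2"
    using \<theta>(2) \<mu>(2) x(2) cardL by simp
  moreover obtain \<eta> where "\<forall>i\<in>I. \<eta> i \<in> {-1, 1}"
    "(\<Sum>i\<in>I. \<eta> i *\<^sub>R v i) = (\<Sum>i\<in>L. \<mu> i *\<^sub>R v i) + (\<Sum>k<m. \<theta> k *\<^sub>R u k)"
    using signs_reduce_toE[OF signs, of \<mu> \<theta>] \<mu>(1) \<theta>(1) by blast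
  ultimately show ?thesis by (intro exI[of _ \<eta>]) simp
qed

section \<open>Assembling the bound\<close>

text \<open>The constant 33 is 32 + 1: the pairs cost at most
  \<open>32 * d ^ 3 * \<epsilon>\<close>, and this together with the gain \<open>\<epsilon>\<close>
  must fit into the 1 saved by parity.\<close>

theorem exists_signs_norm_squared_le:
  fixes v :: "'i \<Rightarrow> 'a::euclidean_space"
  assumes I: "finite I" and unit: "\<And>i. i \<in> I \<Longrightarrow> norm (v i) = 1"
    and parity: "even (card I) \<noteq> even DIM('a)"
    and \<epsilon>: "\<epsilon> \<ge> 0" "33 * real DIM('a) ^ 3 * \<epsilon> \<le> 1"
  shows "\<exists>\<eta>. (\<forall>i\<in>I. \<eta> i \<in> {-1, 1::real}) \<and> (norm (\<Sum>i\<in>I. \<eta> i *\<^sub>R v i))\<^sup>2 \<le> real DIM('a) - \<epsilon>"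
proof (rule ccontr)
  assume contra: "\<not> ?thesis"
  define d where "d = DIM('a)"
  have d1: "1 \<le> real d" using DIM_positive[where 'a='a] by (simp add: d_def)
  have "1 * \<epsilon> \<le> real d ^ 3 * \<epsilon>" using d1 \<epsilon> by (intro mult_right_mono) auto
  then have \<epsilon>_small: "33 * \<epsilon> \<le> 1" "33 * (real d ^ 3 * \<epsilon>) \<le> 1" using \<epsilon> by (simp_all add: d_def)
  \<comment> \<open>Rounding carries the negated claim from sign vectors to all points of the
    cube.\<close>
  have large: "real d - \<epsilon> < (norm (\<Sum>i\<in>I. x i *\<^sub>R v i))\<^sup>2 + (\<Sum>i\<in>I. 1 - (x i)\<^sup>2)"
    if x: "\<And>i. i \<in> I \<Longrightarrow> \<bar>x i\<bar> \<le> 1" for x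
  proof -
    obtain \<eta> where \<eta>: "\<forall>i\<in>I. \<eta> i \<in> {-1, 1::real}"
      "(norm (\<Sum>i\<in>I. \<eta> i *\<^sub>R v i))\<^sup>2
        \<le> (norm (\<Sum>i\<in>I. x i *\<^sub>R v i))\<^sup>2 + (\<Sum>i\<in>I. (1 - (x i)\<^sup>2) * (norm (v i))\<^sup>2)"
      using exists_signs_rounding[of I x 0 v] I x by auto
    have "(norm (\<Sum>i\<in>I. \<eta> i *\<^sub>R v i))\<^sup>2 > real d - \<epsilon>" using contra \<eta>(1) by (force simp: d_def)
    then show ?thesis using \<eta>(2) unit by simp
  qed
  obtain x where x: "\<And>i. i \<in> I \<Longrightarrow> \<bar>x i\<bar> \<le> 1" "(\<Sum>i\<in>I. x i *\<^sub>R v i) = 0"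
    "\<forall>a. (\<Sum>i\<in>{i\<in>I. \<bar>x i\<bar> < 1}. a i *\<^sub>R v i) = 0 \<longrightarrow> (\<forall>i\<in>{i\<in>I. \<bar>x i\<bar> < 1}. a i = 0)"
    using exists_balanced_vertex[OF I, of v] by blast
  define F where "F = {i\<in>I. \<bar>x i\<bar> < 1}"
  have F: "finite F" "\<forall>a. (\<Sum>i\<in>F. a i *\<^sub>R v i) = 0 \<longrightarrow> (\<forall>i\<in>F. a i = 0)"
    using x(3) I unfolding F_def by simp_all
  have F_sub: "F \<subseteq> I" by (auto simp: F_def)
  note indep = independent_family_imp_independent_image[of F v, OF F]
  have cardF_le: "card F \<le> d"
    using independent_bound[OF indep(2)] card_image[OF indep(1)] by (simp add: d_def)
  have x_ext: "\<bar>x i\<bar> = 1" if "i \<in> I - F" for i using that x(1)[of i] by (force simp: F_def)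
  have "(\<Sum>i\<in>I. 1 - (x i)\<^sup>2) = (\<Sum>i\<in>F. 1 - (x i)\<^sup>2)"
  proof (intro sum.mono_neutral_right ballI)
    fix i assume "i \<in> I - F"
    then have "(x i)\<^sup>2 = 1" using x_ext by (metis one_power2 power2_abs)
    then show "1 - (x i)\<^sup>2 = 0" by simp
  qed (use I F_sub in auto)
  also have "\<dots> = real (card F) - (\<Sum>i\<in>F. (x i)\<^sup>2)" by (simp add: sum_subtractf)
  finally have lt: "real d - \<epsilon> < real (card F) - (\<Sum>i\<in>F. (x i)\<^sup>2)"
    using large[of x] x by simp
  have "(\<Sum>i\<in>F. (x i)\<^sup>2) \<ge> 0" by (intro sum_nonneg) auto
  \<comment> \<open>As \<open>\<epsilon> < 1\<close>, integrality leaves only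
    \<open>card F = d\<close>; then \<open>lt\<close> says that the fractional values are almost
    0.\<close>
  then have "real d - 1 < real (card F)" using lt \<epsilon>_small by linarith
  then have card_F: "card F = d" using cardF_le by linarith
  then have x_small: "(\<Sum>i\<in>F. (x i)\<^sup>2) \<le> \<epsilon>" using lt by linarith
  have "span (v ` F) = UNIV"
    using indep card_F card_image[OF indep(1)]
    by (metis UNIV_I card_eq_dim d_def dim_UNIV dim_subset_UNIV finite_imageI F(1) subset_UNIV
        subset_antisym order_refl)
  then have span: "\<exists>a. w = (\<Sum>i\<in>F. a i *\<^sub>R v i)" for w
  proof -
    have "w \<in> span (v ` F)" using \<open>span (v ` F) = UNIV\<close> by simp
    then obtain f where "w = (\<Sum>b\<in>v ` F. f b *\<^sub>R b)"
      using span_finite[of "v ` F"] F(1) by auto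
    then show ?thesis using indep(1) by (intro exI[of _ "\<lambda>i. f (v i)"]) (simp add: sum.reindex)
  qed
  have "\<exists>i\<in>F. \<exists>s\<in>{-1, 1::real}. (norm (v j - s *\<^sub>R v i))\<^sup>2 \<le> 8 * real d ^ 2 * \<epsilon>" if "j \<in> I" for j
  proof (cases "j \<in> F")
    case True
    then show ?thesis using \<epsilon> by (intro bexI[of _ j] bexI[of _ 1]) auto
  next
    case False
    obtain a where "v j = (\<Sum>i\<in>F. a i *\<^sub>R v i)" using span by blast
    then show ?thesis
      using near_basis_vector_of_signed_sums_large[of I F j v d \<epsilon> x a]
        I F_sub that False unit card_F \<epsilon> large x_ext x(2) x_small by (auto simp: d_def)
  qed
  then obtain c s where c: "\<And>j. j \<in> I \<Longrightarrow> c j \<in> F" and s: "\<And>j. j \<in> I \<Longrightarrow> s j \<in> {-1, 1::real}"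
    and near: "\<And>j. j \<in> I \<Longrightarrow> (norm (v j - s j *\<^sub>R v (c j)))\<^sup>2 \<le> 8 * real d ^ 2 * \<epsilon>"
    by metis
  define \<delta> where "\<delta> = sqrt (8 * real d ^ 2 * \<epsilon>)"
  have near': "norm (v j - s j *\<^sub>R v (c j)) \<le> \<delta>" if "j \<in> I" for j
    using near[OF that] by (simp add: \<delta>_def real_le_rsqrt)
  have close: "\<exists>s\<in>{-1, 1::real}. norm (v i + s *\<^sub>R v j) \<le> 2 * \<delta>"
    if ij: "i \<in> I" "j \<in> I" "c i = c j" for i j
  \<comment> \<open>With common centre \<open>v (c i)\<close>, both \<open>v i\<close> and
    \<open>(s i * s j) *\<^sub>R v j\<close> are within \<delta> of
    \<open>s i *\<^sub>R v (c i)\<close>, because \<open>s j * s j = 1\<close>.\<close>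
  proof (intro bexI[of _ "- (s i * s j)"])
    have ss: "s j * s j = 1" "\<bar>s i * s j\<bar> = 1" using s[OF ij(1)] s[OF ij(2)] by auto
    have "v i + (- (s i * s j)) *\<^sub>R v j
        = (v i - s i *\<^sub>R v (c i)) - (s i * s j) *\<^sub>R (v j - s j *\<^sub>R v (c j))"
      using ss(1) ij(3) by (simp add: algebra_simps)
    also have "norm \<dots> \<le> norm (v i - s i *\<^sub>R v (c i)) + norm ((s i * s j) *\<^sub>R (v j - s j *\<^sub>R v (c j)))"
      by (rule norm_triangle_ineq4)
    also have "\<dots> \<le> 2 * \<delta>" using near'[OF ij(1)] near'[OF ij(2)] ss(2) by simp
    finally show "norm (v i + (- (s i * s j)) *\<^sub>R v j) \<le> 2 * \<delta>" .
    show "- (s i * s j) \<in> {-1, 1}" using s[OF ij(1)] s[OF ij(2)] by auto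
  qed
  obtain \<eta> where \<eta>: "\<forall>i\<in>I. \<eta> i \<in> {-1, 1::real}"
    "(norm (\<Sum>i\<in>I. \<eta> i *\<^sub>R v i))\<^sup>2 \<le> real d - 1 + real d * (2 * \<delta>)\<^sup>2"
    using exists_signs_of_clusters[of I v c F "2 * \<delta>"] I unit c F(1) cardF_le parity close
    unfolding d_def by (simp add: image_subset_iff) blast
  have "real d * (2 * \<delta>)\<^sup>2 = 32 * (real d ^ 3 * \<epsilon>)"
    using \<epsilon> by (simp add: \<delta>_def power_mult_distrib power2_eq_square power3_eq_cube)
  then have "(norm (\<Sum>i\<in>I. \<eta> i *\<^sub>R v i))\<^sup>2 \<le> real d - \<epsilon>"
    using \<eta>(2) \<epsilon>_small by linarith
  then show False using contra \<eta>(1) by (auto simp: d_def)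
qed

theorem theorem1p5:
  shows "(\<exists>\<epsilon>::real. \<epsilon> > 0 \<and>
            (\<forall>(n::nat) (v::nat \<Rightarrow> real ^ 'd).
               \<not> [n = CARD('d)] (mod 2) \<longrightarrow> (\<forall>i\<in>{1..n}. norm (v i) = 1) \<longrightarrow>
               (\<exists>\<eta>::nat \<Rightarrow> real. (\<forall>i\<in>{1..n}. \<eta> i \<in> {-1, 1}) \<and>
                  norm (\<Sum>i=1..n. \<eta> i *\<^sub>R v i) \<le> sqrt (real CARD('d) - \<epsilon>))))
       \<and> (\<forall>(n::nat) (v::nat \<Rightarrow> real ^ 'd).
               \<not> [n = CARD('d)] (mod 2) \<longrightarrow> (\<forall>i\<in>{1..n}. norm (v i) = 1) \<longrightarrow>
               (\<exists>\<eta>::nat \<Rightarrow> real. (\<forall>i\<in>{1..n}. \<eta> i \<in> {-1, 1}) \<and>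
                  norm (\<Sum>i=1..n. \<eta> i *\<^sub>R v i)
                    \<le> sqrt (real CARD('d) - 1 / (2 ^ 100 * real CARD('d) ^ 80))))"
    (is "(\<exists>\<epsilon>. \<epsilon> > 0 \<and> ?P \<epsilon>) \<and> ?P ?\<epsilon>")
proof -
  have d: "1 \<le> real CARD('d)" by (simp add: Suc_leI)
  \<comment> \<open>The explicit value lies far below the admissible
    \<open>1 / (33 * d ^ 3)\<close>; it also witnesses the existential claim.\<close>
  have "33 * real CARD('d) ^ 3 \<le> 2 ^ 100 * real CARD('d) ^ 80"
    using d by (intro mult_mono power_increasing) auto
  then have small: "33 * real CARD('d) ^ 3 * ?\<epsilon> \<le> 1" using d by (simp add: divide_le_eq)
  have "?P ?\<epsilon>"
  proof (intro allI impI)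
    fix n :: nat and v :: "nat \<Rightarrow> real ^ 'd"
    assume n: "\<not> [n = CARD('d)] (mod 2)" and unit: "\<forall>i\<in>{1..n}. norm (v i) = 1"
    have "even (card {1..n}) \<noteq> even DIM(real ^ 'd)"
      using n by (simp add: cong_def even_iff_mod_2_eq_zero) presburger
    then obtain \<eta> where "\<forall>i\<in>{1..n}. \<eta> i \<in> {-1, 1::real}"
      "(norm (\<Sum>i=1..n. \<eta> i *\<^sub>R v i))\<^sup>2 \<le> real CARD('d) - ?\<epsilon>"
      using exists_signs_norm_squared_le[of "{1..n}" v ?\<epsilon>] unit small by auto
    then show "\<exists>\<eta>::nat \<Rightarrow> real. (\<forall>i\<in>{1..n}. \<eta> i \<in> {-1, 1}) \<and>
        norm (\<Sum>i=1..n. \<eta> i *\<^sub>R v i) \<le> sqrt (real CARD('d) - ?\<epsilon>)"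
      by (intro exI[of _ \<eta>] conjI real_le_rsqrt)
  qed
  moreover have "?\<epsilon> > 0" using d by simp
  ultimately show ?thesis by blast
qed

end
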